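(* For any tensor $\mathcal{A}\in\mathbb{T}_{m,n}$ with $m>2$ and any $q\in\mathbb{R}^n$, let the function $F:X\subseteq\mathbb{R}^n\to\mathbb{R}^n$ be defined by $F(x):=\mathcal{A}x^{m-1}+q$. Suppose that $0\in X\subseteq\mathbb{R}^n$. Then the function $F$ is not strongly monotone on $X$.
   Context: For positive integers $m,n$, $\mathbb{T}_{m,n}$ denotes the set of all $m$-order $n$-dimensional real tensors $\mathcal{A}=(a_{i_1i_2\cdots i_m})$, with $a_{i_1i_2\cdots i_m}\in\mathbb{R}$ for $i_1,\ldots,i_m\in[n]:=\{1,\ldots,n\}$. For $x\in\mathbb{R}^n$, $\mathcal{A}x^{m-1}\in\mathbb{R}^n$ is the vector with components $(\mathcal{A}x^{m-1})_i=\sum_{i_2,\ldots,i_m=1}^n a_{ii_2\cdots i_m}x_{i_2}\cdots x_{i_m}$, $i\in[n]$. A mapping $F:X\subseteq\mathbb{R}^n\to\mathbb{R}^n$ is strongly monotone on $X$ if and only if there exists a constant $c>0$ such that $\langle F(x)-F(y),x-y\rangle\ge c\|x-y\|^2$ for all $x,y\in X$.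
   Formalization: The formal statement additionally assumes that 0 is a limit point of X; with only 0 ∈ X the claim is false, e.g. for X = {0}, or for n = 1, m = 4, F(x) = x^3 and X = {0, 1}. *)

theory Defs
  imports "HOL-Analysis.Analysis"
begin

(* An m-order tensor of dimension CARD('n) assigns a real to every index word (i_1, ..., i_m),
   encoded as a list of length m.  Extensionality makes equality of tensors entrywise equality. *)
definition tensors :: "nat \<Rightarrow> ('n::finite list \<Rightarrow> real) set" where
  "tensors m = {is. length is = m} \<rightarrow>\<^sub>E UNIV"

(* The vector A x^(m-1).  The order m is an argument because it is not determined by the type;
   the summation set is finite, and js ranges over the words (i_2, ..., i_m). *)
definition tensor_apply :: "nat \<Rightarrow> ('n::finite list \<Rightarrow> real) \<Rightarrow> real ^ 'n \<Rightarrow> real ^ 'n" where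
  "tensor_apply m A x =
     (\<chi> i. \<Sum>js | length js = m - 1. A (i # js) * (\<Prod>j\<leftarrow>js. x $ j))"

definition strongly_monotone_on :: "'a::real_inner set \<Rightarrow> ('a \<Rightarrow> 'a) \<Rightarrow> bool" where
  "strongly_monotone_on X F \<longleftrightarrow>
     (\<exists>c>0. \<forall>x\<in>X. \<forall>y\<in>X. (F x - F y) \<bullet> (x - y) \<ge> c * (norm (x - y))\<^sup>2)"

(* The proposition is formulated for sets X in which 0 is not isolated (0 islimpt X).  Merely
   assuming 0 \<in> X is not enough: every map is strongly monotone on X = {0}, and for n = 1 and
   m = 4 the map x \<mapsto> x^3 is strongly monotone (with c = 1) on X = {0, 1}. *)

end

(* At x \<in> X, strong monotonicity against the point 0 gives c |x|^2 \<le> \<langle>A x^(m-1), x\<rangle>, while the right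
   side is at most C |x|^m because A x^(m-1) is homogeneous of degree m - 1.  As m > 2, this fails
   for x \<noteq> 0 close to 0. *)
theory Submission
  imports Defs
begin

lemma abs_prod_list_component_le:
  fixes x :: "real ^ 'n"
  shows "\<bar>\<Prod>j\<leftarrow>js. x $ j\<bar> \<le> norm x ^ length js"
  by (induction js) (auto simp: abs_mult intro!: mult_mono component_le_norm_cart)

text \<open>Each coordinate is a sum of monomials of degree \<open>m - 1\<close>, and every variable
  in them is at most \<open>norm x\<close> in absolute value. Summing over the coordinates then
  suffices, since the Euclidean norm is at most the l1 norm; the constant is crude but independent
  of \<open>x\<close>.\<close>

lemma norm_tensor_apply_le:
  fixes A :: "'n::finite list \<Rightarrow> real"
  shows "norm (tensor_apply m A x)
           \<le> (\<Sum>i\<in>UNIV. \<Sum>js | length js = m - 1. \<bar>A (i # js)\<bar>) * norm x ^ (m - 1)"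
proof -
  have "\<bar>tensor_apply m A x $ i\<bar>
          \<le> (\<Sum>js | length js = m - 1. \<bar>A (i # js)\<bar>) * norm x ^ (m - 1)" for i
  proof -
    have "\<bar>tensor_apply m A x $ i\<bar>
            \<le> (\<Sum>js | length js = m - 1. \<bar>A (i # js) * (\<Prod>j\<leftarrow>js. x $ j)\<bar>)"
      by (simp add: tensor_apply_def)
    also have "\<dots> \<le> (\<Sum>js | length js = m - 1. \<bar>A (i # js)\<bar> * norm x ^ (m - 1))"
      using abs_prod_list_component_le[of x]
      by (intro sum_mono) (auto simp: abs_mult intro!: mult_left_mono, metis)
    finally show ?thesis
      by (simp add: sum_distrib_right)
  qed
  then have "(\<Sum>i\<in>UNIV. \<bar>tensor_apply m A x $ i\<bar>)
      \<le> (\<Sum>i\<in>UNIV. (\<Sum>js | length js = m - 1. \<bar>A (i # js)\<bar>) * norm x ^ (m - 1))"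
    by (intro sum_mono)
  then show ?thesis
    using norm_le_l1_cart[of "tensor_apply m A x"] by (simp add: sum_distrib_right)
qed

theorem proposition4p1:
  fixes m :: nat
    and A :: "'n::finite list \<Rightarrow> real"
    and q :: "real ^ 'n"
    and X :: "(real ^ 'n) set"
    and F :: "real ^ 'n \<Rightarrow> real ^ 'n"
  assumes "m > 2"
    and "A \<in> tensors m"
    and "0 \<in> X"
    and "0 islimpt X"
    and "\<And>x. x \<in> X \<Longrightarrow> F x = tensor_apply m A x + q"
  shows "\<not> strongly_monotone_on X F"
proof
  assume "strongly_monotone_on X F"
  then obtain c where "c > 0"
    and mono: "\<And>x y. x \<in> X \<Longrightarrow> y \<in> X \<Longrightarrow> c * (norm (x - y))\<^sup>2 \<le> (F x - F y) \<bullet> (x - y)"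
    unfolding strongly_monotone_on_def by blast
  define C where "C = (\<Sum>i\<in>UNIV. \<Sum>js | length js = m - 1. \<bar>A (i # js)\<bar>)"
  have "C \<ge> 0"
    unfolding C_def by (intro sum_nonneg) auto
  have bound: "norm (tensor_apply m A x) \<le> C * norm x ^ (m - 1)" for x
    unfolding C_def by (rule norm_tensor_apply_le)
  \<comment> \<open>The exponent \<open>m - 1\<close> is positive, so the bound at 0 is
    \<open>C * 0\<close>.\<close>
  have zero: "tensor_apply m A 0 = 0"
    using bound[of 0] \<open>m > 2\<close> by (simp add: power_0_left)
  \<comment> \<open>The radius 1 allows the exponent \<open>m - 1\<close> to be lowered to 2; the
    radius \<open>c / (C + 1)\<close> gives the final contradiction. The denominator is
    \<open>C + 1\<close> because \<open>C\<close> may be 0.\<close>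
  have "min 1 (c / (C + 1)) > 0"
    using \<open>c > 0\<close> \<open>C \<ge> 0\<close> by simp
  then obtain x where "x \<in> X" "x \<noteq> 0" and x: "norm x < 1" "norm x < c / (C + 1)"
    using \<open>0 islimpt X\<close> unfolding islimpt_approachable
    by (metis dist_0_norm dist_commute min_less_iff_conj)
  \<comment> \<open>In \<open>F x - F 0\<close> the shift \<open>q\<close> cancels and the tensor
    term at 0 vanishes.\<close>
  have "c * (norm x)\<^sup>2 \<le> tensor_apply m A x \<bullet> x"
    using mono[OF \<open>x \<in> X\<close> \<open>0 \<in> X\<close>] assms(5) \<open>x \<in> X\<close> \<open>0 \<in> X\<close> zero by simp
  also have "\<dots> \<le> norm (tensor_apply m A x) * norm x"
    by (rule norm_cauchy_schwarz)
  also have "\<dots> \<le> C * norm x ^ (m - 1) * norm x"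
    using bound by (simp add: mult_right_mono)
  \<comment> \<open>Here \<open>m > 2\<close> enters as \<open>2 \<le> m - 1\<close>: powers of
    \<open>norm x < 1\<close> decrease with the exponent.\<close>
  also have "\<dots> \<le> C * (norm x)\<^sup>2 * norm x"
    using \<open>m > 2\<close> \<open>C \<ge> 0\<close> x(1)
    by (intro mult_right_mono mult_left_mono power_decreasing) auto
  \<comment> \<open>The common factor \<open>(norm x)\<^sup>2\<close> is positive and cancels,
    leaving one power of \<open>norm x\<close> on the right.\<close>
  finally have "c \<le> C * norm x"
    using \<open>x \<noteq> 0\<close> by (simp add: mult.commute mult.left_commute)
  also have "\<dots> \<le> (C + 1) * norm x"
    by (simp add: mult_right_mono)
  also have "\<dots> < c"
    using x(2) \<open>C \<ge> 0\<close> by (simp add: field_simps)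
  finally show False by simp
qed

end
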